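(* Let $n\ge 1$ and $\mathbf{x}=(x_0,\dots,x_{n-1})\in\mathbb{R}^n$. If $$\sum_{i=0}^{n-1}x_i\,x_{(i+j-1)_n}\ge 0\quad\text{for all } j=1,\dots,n,$$ then $\|\mathbf{C}(\mathbf{x})\|=|x_0+\dots+x_{n-1}|$.
   Context: For $m\in\mathbb{Z}$, $m_n=m-\lfloor m/n\rfloor n$ (the least nonnegative residue of $m$ modulo $n$). For $\mathbf{x}=(x_0,\dots,x_{n-1})\in\mathbb{R}^n$, the circulant matrix $\mathbf{C}(\mathbf{x})$ is the $n\times n$ matrix whose first row is $(x_0,x_1,\dots,x_{n-1})$ and each subsequent row is the cyclic right shift of the previous one; i.e. its $(r,c)$ entry ($r,c=1,\dots,n$) is $x_{(c-r) \bmod n}$. $\|\cdot\|$ denotes the spectral norm. *)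

theory Defs
  imports "Jordan_Normal_Form.Spectral_Radius"
begin

(* Rows and columns are numbered from 0; the difference c - r is the same as for
   numbering from 1.  It is taken in int, since it may be negative. *)
definition circulant_mat :: "real vec \<Rightarrow> real mat" where
  "circulant_mat x =
     mat (dim_vec x) (dim_vec x)
       (\<lambda>(r, c). x $ nat ((int c - int r) mod int (dim_vec x)))"

(* The spectral norm of a real matrix is its largest singular value, i.e. the square
   root of the largest eigenvalue of the Gram matrix.  The Gram matrix is real symmetric
   and positive semidefinite, so its real spectrum is its whole spectrum; it is finite,
   and nonempty if A has at least one column, so Max is meaningful. *)
definition spectral_norm :: "real mat \<Rightarrow> real" where
  "spectral_norm A = sqrt (Max (spectrum (transpose_mat A * A)))"

end

theory Submission
  imports Defs
begin

text \<open>
  The correlations in the hypothesis are exactly the entries of the Gram matrix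
  \<open>G = C\<^sup>T C\<close>, so \<open>G\<close> is entrywise nonnegative. Both \<open>C\<close> and \<open>C\<^sup>T\<close> have constant row sums
  \<open>s = x\<^sub>0 + \<dots> + x\<^bsub>n-1\<^esub>\<close>, so \<open>G\<close> has constant row sums \<open>s\<^sup>2\<close>. Hence the all-ones vector is an
  eigenvector of \<open>G\<close> for \<open>s\<^sup>2\<close>, and comparing \<open>G v = k v\<close> at an entry of \<open>v\<close> of maximal modulus
  shows that no eigenvalue exceeds \<open>s\<^sup>2\<close>.
\<close>

lemma eigenvalue_le_row_sum_bound:
  fixes A :: "real mat"
  assumes A: "A \<in> carrier_mat n n"
    and nonneg: "\<And>i j. i < n \<Longrightarrow> j < n \<Longrightarrow> 0 \<le> A $$ (i, j)"
    and rows: "\<And>i. i < n \<Longrightarrow> (\<Sum>j = 0..<n. A $$ (i, j)) \<le> s"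
    and k: "eigenvalue A k"
  shows "k \<le> s"
proof -
  obtain v where v: "v \<in> carrier_vec n" "v \<noteq> 0\<^sub>v n" and Av: "A *\<^sub>v v = k \<cdot>\<^sub>v v"
    using k A unfolding eigenvalue_def eigenvector_def by auto
  obtain l where l: "l < n" "v $ l \<noteq> 0"
    using v by (metis carrier_vecD eq_vecI index_zero_vec)
  define M where "M = Max ((\<lambda>j. \<bar>v $ j\<bar>) ` {0..<n})"
  have "M \<in> (\<lambda>j. \<bar>v $ j\<bar>) ` {0..<n}"
    unfolding M_def using l by (intro Max_in) auto
  then obtain i where i: "i < n" "\<bar>v $ i\<bar> = M" by auto
  have max: "\<bar>v $ j\<bar> \<le> \<bar>v $ i\<bar>" if "j < n" for j
    unfolding i(2) M_def using that by (intro Max_ge) auto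
  \<comment> \<open>The nonzero entry \<open>l\<close> bounds the maximum from below; this
    positivity lets \<open>\<bar>v $ i\<bar>\<close> be cancelled at the end.\<close>
  have pos: "0 < \<bar>v $ i\<bar>"
    using max[OF l(1)] l(2) by linarith
  have "k * v $ i = (A *\<^sub>v v) $ i"
    using Av v i by simp
  also have "\<dots> = (\<Sum>j = 0..<n. A $$ (i, j) * v $ j)"
    using A v i by (simp add: scalar_prod_def)
  finally have eq: "k * v $ i = (\<Sum>j = 0..<n. A $$ (i, j) * v $ j)" .
  \<comment> \<open>Only an upper bound on \<open>k\<close> is wanted, so bounding \<open>k\<close>
    by its absolute value handles negative eigenvalues too.\<close>
  have "k * \<bar>v $ i\<bar> \<le> \<bar>k * v $ i\<bar>"
    by (simp add: abs_mult mult_right_mono)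
  also have "\<dots> \<le> (\<Sum>j = 0..<n. \<bar>A $$ (i, j) * v $ j\<bar>)"
    unfolding eq by (rule sum_abs)
  also have "\<dots> \<le> (\<Sum>j = 0..<n. A $$ (i, j) * \<bar>v $ i\<bar>)"
    using nonneg[OF i(1)] max by (intro sum_mono) (simp add: abs_mult mult_left_mono)
  also have "\<dots> = (\<Sum>j = 0..<n. A $$ (i, j)) * \<bar>v $ i\<bar>"
    by (simp add: sum_distrib_right)
  also have "\<dots> \<le> s * \<bar>v $ i\<bar>"
    using rows[OF i(1)] by (simp add: mult_right_mono)
  finally show ?thesis using pos by simp
qed

lemma eigenvalue_constant_row_sum:
  fixes A :: "'a :: field mat"
  assumes A: "A \<in> carrier_mat n n" and n: "n > 0"
    and rows: "\<And>i. i < n \<Longrightarrow> (\<Sum>j = 0..<n. A $$ (i, j)) = s"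
  shows "eigenvalue A s"
proof -
  let ?v = "vec n (\<lambda>_. 1 :: 'a)"
  have "?v $ 0 \<noteq> 0\<^sub>v n $ 0"
    using n by simp
  then have "?v \<noteq> 0\<^sub>v n" by metis
  moreover have "A *\<^sub>v ?v = s \<cdot>\<^sub>v ?v"
    using A rows by (intro eq_vecI) (auto simp: scalar_prod_def)
  ultimately have "eigenvector A ?v s"
    using A by (simp add: eigenvector_def)
  then show ?thesis
    unfolding eigenvalue_def by blast
qed

text \<open>Reindexing along a row of the circulant uses \<open>u = 1\<close>, along a column
  \<open>u = -1\<close>. Since \<open>u\<close> is its own inverse, subtracting \<open>a\<close> and
  multiplying by \<open>u\<close> recovers \<open>i\<close> modulo \<open>n\<close>; an injective
  self-map of a finite set is onto.\<close>

lemma bij_betw_mod_affine: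
  fixes a u :: int
  assumes u: "u * u = 1" and n: "n > 0"
  shows "bij_betw (\<lambda>i. nat ((a + u * int i) mod int n)) {0..<n} {0..<n}"
proof -
  let ?f = "\<lambda>i. nat ((a + u * int i) mod int n)"
  have "inj_on ?f {0..<n}"
  proof (rule inj_onI)
    fix i j assume ij: "i \<in> {0..<n}" "j \<in> {0..<n}" "?f i = ?f j"
    have "(a + u * int i) mod int n = (a + u * int j) mod int n"
      using ij(3) n by (simp add: nat_eq_iff)
    then have "(u * ((a + u * int i) - a)) mod int n = (u * ((a + u * int j) - a)) mod int n"
      by (metis mod_diff_left_eq mod_mult_right_eq)
    then have "int i mod int n = int j mod int n"
      using u by (simp flip: mult.assoc)
    then show "i = j" using ij by simp
  qed
  moreover have "?f ` {0..<n} \<subseteq> {0..<n}"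
    using n by (auto simp: nat_less_iff)
  ultimately show ?thesis
    by (simp add: bij_betw_def endo_inj_surj)
qed

lemma circulant_mat_carrier [simp]:
  "x \<in> carrier_vec n \<Longrightarrow> circulant_mat x \<in> carrier_mat n n"
  by (simp add: circulant_mat_def)

lemma circulant_mat_index:
  assumes "x \<in> carrier_vec n" "r < n" "c < n"
  shows "circulant_mat x $$ (r, c) = x $ nat ((int c - int r) mod int n)"
  using assms by (auto simp: circulant_mat_def)

lemma circulant_row_sum:
  assumes "x \<in> carrier_vec n" "r < n"
  shows "(\<Sum>c = 0..<n. circulant_mat x $$ (r, c)) = (\<Sum>i = 0..<n. x $ i)"
  using assms sum.reindex_bij_betw[OF bij_betw_mod_affine[of 1 n "- int r"], of "\<lambda>i. x $ i"]
  by (simp add: circulant_mat_index)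

lemma circulant_col_sum:
  assumes "x \<in> carrier_vec n" "c < n"
  shows "(\<Sum>r = 0..<n. circulant_mat x $$ (r, c)) = (\<Sum>i = 0..<n. x $ i)"
  using assms sum.reindex_bij_betw[OF bij_betw_mod_affine[of "-1" n "int c"], of "\<lambda>i. x $ i"]
  by (simp add: circulant_mat_index)

lemma gram_index:
  fixes A :: "'a :: comm_semiring_0 mat"
  assumes "A \<in> carrier_mat m n" "i < n" "k < n"
  shows "(transpose_mat A * A) $$ (i, k) = (\<Sum>r = 0..<m. A $$ (r, i) * A $$ (r, k))"
  using assms by (simp add: scalar_prod_def)

lemma circulant_gram_row_sum:
  assumes x: "x \<in> carrier_vec n" and i: "i < n"
  shows "(\<Sum>k = 0..<n. (transpose_mat (circulant_mat x) * circulant_mat x) $$ (i, k))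
    = (\<Sum>i = 0..<n. x $ i)\<^sup>2"
proof -
  let ?C = "circulant_mat x"
  have "(\<Sum>k = 0..<n. (transpose_mat ?C * ?C) $$ (i, k))
      = (\<Sum>k = 0..<n. \<Sum>r = 0..<n. ?C $$ (r, i) * ?C $$ (r, k))"
    using x i by (intro sum.cong) (simp_all add: gram_index[of _ n n] del: index_mult_mat)
  \<comment> \<open>After the swap the inner sum is a row sum of the circulant, independent of
    \<open>r\<close>; pulling it out leaves the sum of column \<open>i\<close>.\<close>
  also have "\<dots> = (\<Sum>r = 0..<n. ?C $$ (r, i) * (\<Sum>k = 0..<n. ?C $$ (r, k)))"
    by (subst sum.swap) (simp add: sum_distrib_left)
  also have "\<dots> = (\<Sum>r = 0..<n. ?C $$ (r, i) * (\<Sum>i = 0..<n. x $ i))"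
    using x by (intro sum.cong) (simp_all add: circulant_row_sum)
  also have "\<dots> = (\<Sum>i = 0..<n. x $ i)\<^sup>2"
    using x i by (simp add: circulant_col_sum power2_eq_square flip: sum_distrib_right)
  finally show ?thesis .
qed

text \<open>Substituting \<open>m = (i - r) mod n\<close> in the sum over \<open>r\<close> turns the
  product of columns \<open>i\<close> and \<open>k\<close> into the cyclic autocorrelation of
  \<open>x\<close> at lag \<open>k - i\<close>.\<close>

lemma circulant_gram_index:
  assumes x: "x \<in> carrier_vec n" and i: "i < n" and k: "k < n"
  shows "(transpose_mat (circulant_mat x) * circulant_mat x) $$ (i, k)
    = (\<Sum>m = 0..<n. x $ m * x $ ((m + nat ((int k - int i) mod int n)) mod n))"
proof -
  define d where "d = nat ((int k - int i) mod int n)"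
  \<comment> \<open>Spelled with \<open>- 1 *\<close> to match \<open>bij_betw_mod_affine\<close>
    for \<open>u = -1\<close>.\<close>
  let ?f = "\<lambda>r. nat ((int i + - 1 * int r) mod int n)"
  \<comment> \<open>This is \<open>k - r = (i - r) + (k - i)\<close> modulo \<open>n\<close>: in
    every row, the two factors sit at the same cyclic distance \<open>d\<close>.\<close>
  have shift: "nat ((int k - int r) mod int n) = (?f r + d) mod n" for r
  proof -
    have "int ((?f r + d) mod n) = (int i - int r + (int k - int i)) mod int n"
      using k by (simp add: d_def zmod_int mod_add_eq)
    then have "(int k - int r) mod int n = int ((?f r + d) mod n)"
      by simp
    then show ?thesis
      by (simp only: nat_int)
  qed
  have "(transpose_mat (circulant_mat x) * circulant_mat x) $$ (i, k)
      = (\<Sum>r = 0..<n. x $ ?f r * x $ ((?f r + d) mod n))"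
    unfolding gram_index[OF circulant_mat_carrier[OF x] i k] shift[symmetric]
    using x i k by (intro sum.cong) (simp_all add: circulant_mat_index)
  also have "\<dots> = (\<Sum>m = 0..<n. x $ m * x $ ((m + d) mod n))"
    using i by (intro sum.reindex_bij_betw bij_betw_mod_affine) simp_all
  finally show ?thesis
    by (simp only: d_def)
qed

theorem theorem4:
  fixes n :: nat and x :: "real vec"
  assumes "n \<ge> 1"
    and "x \<in> carrier_vec n"
    and "\<forall>j\<in>{1..n}. (\<Sum>i = 0..<n. x $ i * x $ ((i + j - 1) mod n)) \<ge> 0"
  shows "spectral_norm (circulant_mat x) = \<bar>\<Sum>i = 0..<n. x $ i\<bar>"
proof -
  let ?s = "\<Sum>i = 0..<n. x $ i"
  define G where "G = transpose_mat (circulant_mat x) * circulant_mat x"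
  note x = assms(2)
  have n: "n > 0" using assms(1) by simp
  have G: "G \<in> carrier_mat n n"
    unfolding G_def using circulant_mat_carrier[OF x] by simp
  have rows: "(\<Sum>k = 0..<n. G $$ (i, k)) = ?s\<^sup>2" if "i < n" for i
    unfolding G_def by (rule circulant_gram_row_sum[OF x that])
  have nonneg: "0 \<le> G $$ (i, k)" if "i < n" "k < n" for i k
  proof -
    have "nat ((int k - int i) mod int n) < n"
      using n by (simp add: nat_less_iff)
    \<comment> \<open>The hypothesis counts lags from 1, with \<open>j\<close> standing for lag
      \<open>j - 1\<close>; hence lag \<open>k - i\<close> modulo \<open>n\<close> is its instance
      at the successor.\<close>
    then have "Suc (nat ((int k - int i) mod int n)) \<in> {1..n}"
      by simp
    from bspec[OF assms(3) this] show ?thesis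
      unfolding G_def circulant_gram_index[OF x that] by simp
  qed
  have "Max (spectrum G) = ?s\<^sup>2"
  proof (rule Max_eqI)
    show "finite (spectrum G)"
      using card_finite_spectrum(1)[OF G] .
    show "?s\<^sup>2 \<in> spectrum G"
      using eigenvalue_constant_row_sum[OF G n rows] by (simp add: spectrum_def)
    show "k \<le> ?s\<^sup>2" if "k \<in> spectrum G" for k
      using eigenvalue_le_row_sum_bound[OF G nonneg] rows that by (simp add: spectrum_def)
  qed
  then show ?thesis
    by (simp add: spectral_norm_def flip: G_def)
qed

end
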